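(* Let $\mathcal{H}$ be a Hilbert space and let $T\in\mathcal{L}(\mathcal{H})$ belong to the class $\mathcal{D}$. Then $W:=\mathcal{H}\ominus T\mathcal{H}$ is a wandering subspace for $T$ and $$\mathcal{H}=\mathcal{H}_{\infty}\oplus\mathcal{H}_s\quad\text{(orthogonal direct sum)},$$ where $$\mathcal{H}_{\infty}=\bigcap_{n=1}^{\infty}T^n\mathcal{H},\qquad \mathcal{H}_s=\bigoplus_{n=0}^{\infty}T^nW.$$ The subspaces $\mathcal{H}_{\infty}$ and $\mathcal{H}_s$ are reducing subspaces of $T$, and $T|_{\mathcal{H}_{\infty}}:\mathcal{H}_\infty\to\mathcal{H}_\infty$ is bijective. The decomposition is unique: if $\mathcal{H}=\mathcal{H}_{\infty}'\oplus\mathcal{H}_s'$ is an orthogonal decomposition into reducing subspaces of $T$ such that $T|_{\mathcal{H}_\infty'}:\mathcal{H}_\infty'\to\mathcal{H}_\infty'$ is bijective and $\mathcal{H}_s'=\bigoplus_{n=0}^{\infty}T^nW'$ for some wandering subspace $W'$ for $T$, then $\mathcal{H}_\infty'=\mathcal{H}_\infty$ and $\mathcal{H}_s'=\mathcal{H}_s$.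
   Context: $\mathcal{L}(\mathcal{H})$ is the algebra of bounded linear operators on the Hilbert space $\mathcal{H}$. If $T\in\mathcal{L}(\mathcal{H})$ is left invertible (equivalently, $T^*T$ is invertible), then every power $T^n$ is left invertible and one sets $T^{-}:=(T^*T)^{-1}T^*$. The class $\mathcal{D}$ is the set of all left invertible operators $T\in\mathcal{L}(\mathcal{H})$ such that $(T^n)^{-}=(T^{-})^n$ for all $n\ge 2$, where $(T^n)^{-}=({T^*}^nT^n)^{-1}{T^*}^n$. $\mathcal{H}\ominus T\mathcal{H}$ is the orthogonal complement of $T\mathcal{H}$ in $\mathcal{H}$. A closed subspace $W$ is a wandering subspace for $T$ if $T^mW\perp T^nW$ for all integers $m,n\ge 0$ with $m\neq n$. A closed subspace reduces $T$ if it is invariant under both $T$ and $T^*$. $\bigoplus_{n=0}^\infty$ denotes the (closed) orthogonal Hilbert direct sum inside $\mathcal{H}$. *)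

theory Defs
  imports "HOL-Analysis.Analysis"
begin

text \<open>
  Complex Hilbert spaces. The inner product \<open>cinner\<close> is linear in its first argument. The real
  inner product of the superclass is required to be its real part, so that norm, topology,
  positive definiteness and completeness are those of the library; every complex Hilbert space
  becomes an instance by putting \<open>inner x y = Re (cinner x y)\<close>.
\<close>

class complex_inner = real_inner +
  fixes scaleC :: "complex \<Rightarrow> 'a \<Rightarrow> 'a" (infixr "*\<^sub>C" 75)
    and cinner :: "'a \<Rightarrow> 'a \<Rightarrow> complex"
  assumes scaleC_add_right: "a *\<^sub>C (x + y) = a *\<^sub>C x + a *\<^sub>C y"
    and scaleC_add_left: "(a + b) *\<^sub>C x = a *\<^sub>C x + b *\<^sub>C x"
    and scaleC_scaleC: "a *\<^sub>C (b *\<^sub>C x) = (a * b) *\<^sub>C x"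
    and scaleC_of_real: "of_real r *\<^sub>C x = r *\<^sub>R x"
    and cinner_commute: "cinner x y = cnj (cinner y x)"
    and cinner_add_left: "cinner (x + y) z = cinner x z + cinner y z"
    and cinner_scaleC_left: "cinner (a *\<^sub>C x) y = a * cinner x y"
    and inner_eq_Re_cinner: "inner x y = Re (cinner x y)"

class chilbert_space = complex_inner + complete_space
begin
subclass banach ..
end

instantiation complex :: chilbert_space
begin
definition scaleC_complex :: "complex \<Rightarrow> complex \<Rightarrow> complex" where
  "scaleC_complex a x = a * x"
definition cinner_complex :: "complex \<Rightarrow> complex \<Rightarrow> complex" where
  "cinner_complex x y = x * cnj y"
instance
  by standard
    (auto simp: scaleC_complex_def cinner_complex_def algebra_simps scaleR_conv_of_real
      inner_complex_def)
end

definition bounded_clinear :: "('a::chilbert_space \<Rightarrow> 'a) \<Rightarrow> bool" where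
  "bounded_clinear T \<longleftrightarrow> bounded_linear T \<and> (\<forall>c x. T (c *\<^sub>C x) = c *\<^sub>C T x)"

definition cadjoint :: "('a::chilbert_space \<Rightarrow> 'a) \<Rightarrow> 'a \<Rightarrow> 'a" where
  "cadjoint T = (THE S. \<forall>x y. cinner (T x) y = cinner x (S y))"

definition left_invertible :: "('a::chilbert_space \<Rightarrow> 'a) \<Rightarrow> bool" where
  "left_invertible T \<longleftrightarrow> (\<exists>S. bounded_clinear S \<and> S \<circ> T = id)"

definition left_inverse :: "('a::chilbert_space \<Rightarrow> 'a) \<Rightarrow> 'a \<Rightarrow> 'a" where
  "left_inverse T = inv (cadjoint T \<circ> T) \<circ> cadjoint T"

definition class_D :: "('a::chilbert_space \<Rightarrow> 'a) set" where
  "class_D = {T. bounded_clinear T \<and> left_invertible T \<and>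
     (\<forall>n\<ge>2. left_inverse (T ^^ n) = left_inverse T ^^ n)}"

definition closed_csubspace :: "'a::chilbert_space set \<Rightarrow> bool" where
  "closed_csubspace M \<longleftrightarrow> subspace M \<and> (\<forall>c. \<forall>x\<in>M. c *\<^sub>C x \<in> M) \<and> closed M"

definition corthogonal :: "'a::chilbert_space set \<Rightarrow> 'a set \<Rightarrow> bool" where
  "corthogonal A B \<longleftrightarrow> (\<forall>x\<in>A. \<forall>y\<in>B. cinner x y = 0)"

definition ortho_complement :: "'a::chilbert_space set \<Rightarrow> 'a set" where
  "ortho_complement A = {x. \<forall>y\<in>A. cinner x y = 0}"

definition wandering_subspace :: "('a::chilbert_space \<Rightarrow> 'a) \<Rightarrow> 'a set \<Rightarrow> bool" where
  "wandering_subspace T W \<longleftrightarrow> closed_csubspace W \<and>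
     (\<forall>m n. m \<noteq> n \<longrightarrow> corthogonal ((T ^^ m) ` W) ((T ^^ n) ` W))"

definition reducing_subspace :: "('a::chilbert_space \<Rightarrow> 'a) \<Rightarrow> 'a set \<Rightarrow> bool" where
  "reducing_subspace T M \<longleftrightarrow> closed_csubspace M \<and> T ` M \<subseteq> M \<and> cadjoint T ` M \<subseteq> M"

definition orthogonal_decomposition :: "'a::chilbert_space set \<Rightarrow> 'a set \<Rightarrow> bool" where
  "orthogonal_decomposition A B \<longleftrightarrow> closed_csubspace A \<and> closed_csubspace B \<and>
     corthogonal A B \<and> (\<forall>x. \<exists>a\<in>A. \<exists>b\<in>B. x = a + b)"

definition orthogonal_family :: "(nat \<Rightarrow> 'a::chilbert_space set) \<Rightarrow> bool" where
  "orthogonal_family M \<longleftrightarrow> (\<forall>n. closed_csubspace (M n)) \<and>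
     (\<forall>m n. m \<noteq> n \<longrightarrow> corthogonal (M m) (M n))"

text \<open>
  The Hilbert direct sum inside the ambient space; meaningful when the family of summands is an
  \<open>orthogonal_family\<close>.
\<close>

definition hilbert_direct_sum :: "(nat \<Rightarrow> 'a::chilbert_space set) \<Rightarrow> 'a set" where
  "hilbert_direct_sum M =
     {x. \<exists>f. (\<forall>n. f n \<in> M n) \<and> summable (\<lambda>n. (norm (f n))\<^sup>2) \<and> f sums x}"

end

theory Submission
  imports Defs
begin

text \<open>
  Write \<open>L\<close> for the left inverse \<open>(T\<^sup>*T)\<^sup>-\<^sup>1T\<^sup>*\<close>. Membership in the class \<open>\<D>\<close> says exactly that
  \<open>T\<^sup>nL\<^sup>n\<close> is the orthogonal projection onto the range of \<open>T\<^sup>n\<close> for every \<open>n\<close>. Hence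
  \<open>ker L\<^sup>n\<close> is the orthogonal complement of that range, so that \<open>T\<^sup>mW \<subseteq> ker L\<^sup>m\<^sup>+\<^sup>1\<close> is orthogonal to
  \<open>T\<^sup>nW\<close> for \<open>m < n\<close>, and telescoping gives
  \<open>x = T\<^sup>nL\<^sup>nx + (\<Sum>k<n. T\<^sup>k(I - TL)L\<^sup>kx)\<close> with \<open>(I - TL)L\<^sup>kx \<in> W\<close>. Letting \<open>n\<close> tend to infinity yields
  the decomposition; the rest follows since the two summands are orthogonal complements of each other.
\<close>

section \<open>Complex inner products\<close>

lemma scaleC_one: "1 *\<^sub>C x = (x::'a::complex_inner)"
  using scaleC_of_real[of 1 x] by simp

lemma cinner_zero_left [simp]: "cinner 0 (y::'a::complex_inner) = 0"
  using cinner_add_left[of 0 0 y] by simp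

lemma cinner_zero_right [simp]: "cinner (y::'a::complex_inner) 0 = 0"
  by (subst cinner_commute) simp

lemma cinner_eq_0_commute: "cinner x y = 0 \<longleftrightarrow> cinner y (x::'a::complex_inner) = 0"
  by (metis cinner_commute complex_cnj_zero)

lemma cinner_minus_left: "cinner (- x) y = - cinner x (y::'a::complex_inner)"
  using cinner_add_left[of x "- x" y] by (simp add: add_eq_0_iff)

lemma cinner_diff_left: "cinner (x - z) y = cinner x y - cinner z (y::'a::complex_inner)"
  using cinner_add_left[of x "- z" y] by (simp add: cinner_minus_left)

lemma cinner_add_right: "cinner x (y + z) = cinner x y + cinner x (z::'a::complex_inner)"
  by (metis cinner_commute cinner_add_left complex_cnj_add)

lemma cinner_diff_right: "cinner x (y - z) = cinner x y - cinner x (z::'a::complex_inner)"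
  by (metis cinner_commute cinner_diff_left complex_cnj_diff)

lemma cinner_scaleC_right: "cinner x (a *\<^sub>C y) = cnj a * cinner x (y::'a::complex_inner)"
  by (metis cinner_commute cinner_scaleC_left complex_cnj_mult)

text \<open>Conjugate linearity in the second argument turns the imaginary part into a real inner
  product with \<open>\<i> *\<^sub>C y\<close>. Continuity of \<open>cinner\<close> thus reduces to
  that of \<open>inner\<close>.\<close>

lemma cinner_eq_inner:
  "cinner x y = of_real (inner x y) + \<i> * of_real (inner x (\<i> *\<^sub>C (y::'a::complex_inner)))"
  by (rule complex_eqI) (simp_all add: inner_eq_Re_cinner cinner_scaleC_right)

lemma cinner_self_eq_0: "cinner x x = 0 \<longleftrightarrow> x = (0::'a::complex_inner)"
  by (metis cinner_zero_left inner_eq_Re_cinner inner_eq_zero_iff zero_complex.simps(1))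

text \<open>The imaginary part is the real part after scaling by \<open>- \<i>\<close>. This lifts
  real representation results to complex ones.\<close>

lemma cinner_eqI:
  fixes x y x' y' :: "'a::complex_inner"
  assumes "\<And>c. inner (c *\<^sub>C x) y = inner (c *\<^sub>C x') y'"
  shows "cinner x y = cinner x' y'"
proof (rule complex_eqI)
  show "Re (cinner x y) = Re (cinner x' y')"
    using assms[of 1] by (simp only: scaleC_one inner_eq_Re_cinner)
  have "Re (- \<i> * cinner x y) = Re (- \<i> * cinner x' y')"
    using assms[of "- \<i>"] by (simp only: cinner_scaleC_left inner_eq_Re_cinner)
  then show "Im (cinner x y) = Im (cinner x' y')" by simp
qed

lemma cinner_right_unique:
  fixes u v :: "'a::complex_inner"
  assumes "\<And>x. cinner x u = cinner x v"
  shows "u = v"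
proof -
  have "cinner (u - v) (u - v) = 0"
    using assms by (simp add: cinner_diff_right)
  then show ?thesis by (simp add: cinner_self_eq_0)
qed

lemma bounded_linear_cinner_left: "bounded_linear (\<lambda>x. cinner x (y::'a::complex_inner))"
  unfolding cinner_eq_inner
  by (intro bounded_linear_add bounded_linear_const_mult bounded_linear_compose[OF bounded_linear_of_real]
      bounded_linear_inner_left)

lemma orthogonal_if_cinner_eq_0: "cinner x y = 0 \<Longrightarrow> orthogonal x (y::'a::complex_inner)"
  by (simp add: orthogonal_def inner_eq_Re_cinner)

section \<open>Closed complex subspaces and orthogonal complements\<close>

lemma closed_csubspaceI:
  fixes M :: "'a::chilbert_space set"
  assumes "0 \<in> M" "\<And>x y. x \<in> M \<Longrightarrow> y \<in> M \<Longrightarrow> x + y \<in> M"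
    "\<And>c x. x \<in> M \<Longrightarrow> c *\<^sub>C x \<in> M" "closed M"
  shows "closed_csubspace M"
  unfolding closed_csubspace_def subspace_def using assms by (metis scaleC_of_real)

lemma closed_csubspace_ortho_complement:
  "closed_csubspace (ortho_complement (A::'a::chilbert_space set))"
proof (rule closed_csubspaceI)
  have eq: "ortho_complement A = (\<Inter>y\<in>A. {x. cinner x y = 0})"
    by (auto simp: ortho_complement_def)
  show "closed (ortho_complement A)"
    unfolding eq
    by (intro closed_INT ballI closed_Collect_eq continuous_on_const
        bounded_linear.continuous_on[OF bounded_linear_cinner_left] continuous_on_id)
qed (auto simp: ortho_complement_def cinner_add_left cinner_scaleC_left)

lemma closed_csubspace_diff:
  "closed_csubspace M \<Longrightarrow> x \<in> M \<Longrightarrow> y \<in> M \<Longrightarrow> x - y \<in> M"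
  by (simp add: closed_csubspace_def subspace_diff)

text \<open>If \<open>x = a + b\<close> is orthogonal to one summand, pairing \<open>x\<close> with
  its component there shows that this component is zero. As complements are closed, closedness of
  both summands is part of the outcome.\<close>

lemma orthogonal_decomposition_complements:
  fixes A B :: "'a::chilbert_space set"
  assumes "0 \<in> A" "0 \<in> B" "corthogonal A B" "\<And>x. \<exists>a\<in>A. \<exists>b\<in>B. x = a + b"
  shows "A = ortho_complement B" "B = ortho_complement A"
proof -
  have AB: "cinner a b = 0" "cinner b a = 0" if "a \<in> A" "b \<in> B" for a b
    using assms(3) that by (auto simp: corthogonal_def cinner_eq_0_commute[of b])
  show "A = ortho_complement B"
  proof (intro equalityI subsetI)
    fix x assume x: "x \<in> ortho_complement B"
    obtain a b where ab: "a \<in> A" "b \<in> B" "x = a + b" using assms(4) by blast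
    have "cinner x b = 0" using x ab(2) by (simp add: ortho_complement_def)
    then have "cinner b b = 0" using ab(3) AB[OF ab(1,2)] by (simp add: cinner_add_left)
    then show "x \<in> A" using ab by (simp add: cinner_self_eq_0)
  qed (use AB in \<open>auto simp: ortho_complement_def\<close>)
  show "B = ortho_complement A"
  proof (intro equalityI subsetI)
    fix x assume x: "x \<in> ortho_complement A"
    obtain a b where ab: "a \<in> A" "b \<in> B" "x = a + b" using assms(4) by blast
    have "cinner x a = 0" using x ab(1) by (simp add: ortho_complement_def)
    then have "cinner a a = 0" using ab(3) AB[OF ab(1,2)] by (simp add: cinner_add_left)
    then show "x \<in> B" using ab by (simp add: cinner_self_eq_0)
  qed (use AB in \<open>auto simp: ortho_complement_def\<close>)
qed

section \<open>Adjoints and left inverses\<close>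

text \<open>
  For \<open>T = id\<close> this is the Riesz representation theorem; for general \<open>T\<close> it also gives the
  surjectivity of \<open>T\<^sup>*T\<close>. The vector \<open>u\<close> minimises \<open>\<parallel>T x\<parallel>\<^sup>2 - 2 f x\<close>.
\<close>

lemma quadratic_functional_representation:
  fixes T :: "'a::{real_inner,complete_space} \<Rightarrow> 'b::real_inner" and f :: "'a \<Rightarrow> real"
  assumes T: "bounded_linear T" and f: "bounded_linear f"
    and c: "c > 0" and below: "\<And>x. c * norm x \<le> norm (T x)"
  shows "\<exists>u. \<forall>x. inner (T x) (T u) = f x"
proof -
  interpret T: bounded_linear T by fact
  interpret f: bounded_linear f by fact
  define q where "q x = (norm (T x))\<^sup>2 - 2 * f x" for x
  obtain K where K: "\<And>x. norm (f x) \<le> norm x * K" using f.bounded by blast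
  \<comment> \<open>Complete the square in \<open>c * norm x\<close>.\<close>
  have q_lower: "q x \<ge> - (K/c)\<^sup>2" for x
  proof -
    have "(c * norm x)\<^sup>2 \<le> (norm (T x))\<^sup>2"
      using below c by (intro power_mono) auto
    moreover have "f x \<le> norm x * K" using K[of x] by simp
    moreover have "(c * norm x)\<^sup>2 - 2 * (norm x * K) + (K/c)\<^sup>2 = (c * norm x - K/c)\<^sup>2"
      using c by (simp add: power2_diff)
    ultimately show ?thesis
      using zero_le_power2[of "c * norm x - K/c"] unfolding q_def by linarith
  qed
  define m where "m = Inf (range q)"
  have bdd: "bdd_below (range q)" using q_lower by (intro bdd_belowI[of _ "- (K/c)\<^sup>2"]) auto
  have m_le: "m \<le> q x" for x unfolding m_def using bdd by (intro cInf_lower) auto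
  define r where "r n = 1 / real (Suc n)" for n
  have "\<exists>x. q x < m + r n" for n
    using cInf_lessD[of "range q" "m + r n"] unfolding m_def r_def by auto
  then obtain X where X: "\<And>n. q (X n) < m + r n" by metis
  \<comment> \<open>Parallelogram law at the midpoint: the terms in \<open>f\<close> cancel, so
    points with nearly minimal \<open>q\<close> are close together.\<close>
  have par: "c\<^sup>2 * (norm (x - y))\<^sup>2 \<le> 2 * (q x + q y - 2 * m)" for x y
  proof -
    have "(c * norm (x - y))\<^sup>2 \<le> (norm (T (x - y)))\<^sup>2"
      using below c by (intro power_mono) auto
    moreover have "(norm (T (x - y)))\<^sup>2 = 2 * (q x + q y - 2 * q ((1/2) *\<^sub>R (x + y)))"
      unfolding q_def power2_norm_eq_inner
      by (simp add: T.diff T.add T.scaleR f.scaleR f.add inner_diff_left inner_diff_right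
          inner_add_left inner_add_right inner_commute algebra_simps)
    ultimately show ?thesis using m_le[of "(1/2) *\<^sub>R (x + y)"] by (simp add: power_mult_distrib)
  qed
  have "Cauchy X"
  proof (rule metric_CauchyI)
    fix e :: real assume e: "e > 0"
    define E where "E = c\<^sup>2 * e\<^sup>2"
    have "E > 0" using c e by (simp add: E_def)
    then obtain N where N: "r N < E / 4"
      using reals_Archimedean[of "E / 4"] by (auto simp: inverse_eq_divide r_def)
    have "dist (X i) (X j) < e" if "i \<ge> N" "j \<ge> N" for i j
    proof -
      have "r i \<le> r N" "r j \<le> r N"
        using that by (auto simp: r_def intro!: divide_left_mono)
      then have "2 * (q (X i) + q (X j) - 2 * m) < E"
      proof -
        have "q (X i) < m + E / 4" "q (X j) < m + E / 4"
          using X[of i] X[of j] N \<open>r i \<le> r N\<close> \<open>r j \<le> r N\<close> by linarith+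
        then show ?thesis by (simp add: field_simps)
      qed
      with par[of "X i" "X j"] have "c\<^sup>2 * (norm (X i - X j))\<^sup>2 < c\<^sup>2 * e\<^sup>2"
        unfolding E_def by (rule le_less_trans)
      then have "(norm (X i - X j))\<^sup>2 < e\<^sup>2" using c by simp
      then show ?thesis using e by (simp add: dist_norm power2_less_imp_less)
    qed
    then show "\<exists>M. \<forall>i\<ge>M. \<forall>j\<ge>M. dist (X i) (X j) < e" by blast
  qed
  then obtain u where u: "X \<longlonglongrightarrow> u" using Cauchy_convergent convergent_def by blast
  have "(\<lambda>n. q (X n)) \<longlonglongrightarrow> q u"
    unfolding q_def by (intro tendsto_intros T.tendsto f.tendsto u)
  moreover have "(\<lambda>n. m + r n) \<longlonglongrightarrow> m + 0"
    unfolding r_def by (intro tendsto_add tendsto_const LIMSEQ_Suc[OF lim_1_over_n])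
  ultimately have qu: "q u \<le> m"
    using X by (intro LIMSEQ_le[of "\<lambda>n. q (X n)" _ "\<lambda>n. m + r n"]) (auto intro: less_imp_le)
  have "inner (T x) (T u) = f x" for x
  proof -
    define d where "d = inner (T x) (T u) - f x"
    \<comment> \<open>The summand 1 keeps \<open>N\<close> positive even if \<open>T x = 0\<close>.
      The \<open>t\<close> chosen below minimises \<open>2 * t * d + t\<^sup>2 * N\<close>, a bound
      for the increase of \<open>q\<close> from \<open>u\<close> to
      \<open>u + t *\<^sub>R x\<close>.\<close>
    define N where "N = (norm (T x))\<^sup>2 + 1"
    have N: "N > 0" "(norm (T x))\<^sup>2 < N" unfolding N_def by (simp_all add: add_nonneg_pos)
    define t where "t = - d / N"
    have "q (u + t *\<^sub>R x) = q u + 2 * t * d + t\<^sup>2 * (norm (T x))\<^sup>2"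
      unfolding q_def d_def power2_norm_eq_inner
      by (simp add: T.add T.scaleR f.scaleR f.add inner_add_left inner_add_right inner_commute
          algebra_simps power2_eq_square)
    then have "0 \<le> 2 * t * d + t\<^sup>2 * (norm (T x))\<^sup>2"
      using qu m_le[of "u + t *\<^sub>R x"] by linarith
    also have "\<dots> \<le> 2 * t * d + t\<^sup>2 * N"
      using N by (simp add: mult_left_mono)
    also have "\<dots> = - (d\<^sup>2 / N)"
      using N(1) unfolding t_def by (simp add: field_simps power2_eq_square)
    finally have "d\<^sup>2 / N \<le> 0" by simp
    then have "d = 0" using N(1) by (simp add: divide_le_0_iff)
    then show ?thesis by (simp add: d_def)
  qed
  then show ?thesis by blast
qed

text \<open>Justifies the definite description in \<open>cadjoint\<close>: existence is the real
  Riesz theorem lifted by \<open>cinner_eqI\<close>, uniqueness is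
  \<open>cinner_right_unique\<close>.\<close>

lemma cinner_cadjoint:
  fixes T :: "'a::chilbert_space \<Rightarrow> 'a"
  assumes T: "bounded_clinear T"
  shows "cinner (T x) y = cinner x (cadjoint T y)"
proof -
  have lin: "bounded_linear T" and sc: "\<And>c x. T (c *\<^sub>C x) = c *\<^sub>C T x"
    using T by (auto simp: bounded_clinear_def)
  have "\<forall>y. \<exists>u. \<forall>x. inner x u = inner (T x) y"
  proof
    fix y
    have "bounded_linear (\<lambda>x. inner (T x) y)"
      by (rule bounded_linear_compose[OF bounded_linear_inner_left lin])
    from quadratic_functional_representation[OF bounded_linear_ident this zero_less_one]
    show "\<exists>u. \<forall>x. inner x u = inner (T x) y" by simp
  qed
  from choice[OF this] obtain S where S: "\<And>x y. inner x (S y) = inner (T x) y" by blast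
  have "\<forall>x y. cinner (T x) y = cinner x (S y)"
    by (intro allI cinner_eqI) (simp add: S sc[symmetric])
  then have "\<exists>!S. \<forall>x y. cinner (T x) y = cinner x (S y)"
  proof (rule ex1I[of _ S])
    fix S' assume S': "\<forall>x y. cinner (T x) y = cinner x (S' y)"
    show "S' = S"
      by (rule ext, rule cinner_right_unique) (metis S' \<open>\<forall>x y. cinner (T x) y = cinner x (S y)\<close>)
  qed
  from theI'[OF this, folded cadjoint_def] show ?thesis by simp
qed

lemma left_invertible_bounded_below:
  fixes T :: "'a::chilbert_space \<Rightarrow> 'a"
  assumes "left_invertible T"
  obtains c where "c > 0" "\<And>x. c * norm x \<le> norm (T x)"
proof -
  obtain S where S: "bounded_linear S" and ST: "\<And>x. S (T x) = x"
    using assms by (metis left_invertible_def bounded_clinear_def comp_apply id_apply)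
  obtain K where K: "K > 0" "\<And>x. norm (S x) \<le> norm x * K"
    using bounded_linear.pos_bounded[OF S] by blast
  show ?thesis
  proof (rule that[of "1 / K"])
    show "1 / K * norm x \<le> norm (T x)" for x
      using K(2)[of "T x"] K(1) by (simp add: ST field_simps)
  qed (use K in auto)
qed

text \<open>These are the normal equations: \<open>T (left_inverse T y)\<close> is the orthogonal
  projection of \<open>y\<close> onto the range of \<open>T\<close>. The \<open>inv\<close> in the
  definition is evaluated through surjectivity of \<open>cadjoint T \<circ> T\<close>.\<close>

lemma cinner_left_inverse:
  fixes T :: "'a::chilbert_space \<Rightarrow> 'a"
  assumes T: "bounded_clinear T" and inv: "left_invertible T"
  shows "cinner (T x) (T (left_inverse T y)) = cinner (T x) y"
proof -
  let ?A = "cadjoint T \<circ> T"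
  have lin: "bounded_linear T" and sc: "\<And>c x. T (c *\<^sub>C x) = c *\<^sub>C T x"
    using T by (auto simp: bounded_clinear_def)
  obtain c where c: "c > 0" "\<And>x. c * norm x \<le> norm (T x)"
    using left_invertible_bounded_below[OF inv] by blast
  have "surj ?A"
    unfolding surj_def
  proof
    fix z
    \<comment> \<open>Solving \<open>?A u = z\<close> amounts to representing the functional
      \<open>inner x z\<close> as \<open>inner (T x) (T u)\<close>.\<close>
    obtain u where u: "\<And>x. inner (T x) (T u) = inner x z"
      using quadratic_functional_representation[OF lin bounded_linear_inner_left c, of z] by blast
    have "cinner x (?A u) = cinner x z" for x
    proof -
      have "cinner (T x) (T u) = cinner x z"
        by (rule cinner_eqI) (metis u sc)
      then show ?thesis by (simp add: cinner_cadjoint[OF T])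
    qed
    then have "z = ?A u" by (rule cinner_right_unique[symmetric])
    then show "\<exists>u. z = ?A u" by blast
  qed
  then have "?A (left_inverse T y) = cadjoint T y"
    using surj_f_inv_f[of ?A "cadjoint T y"] by (simp add: left_inverse_def)
  then show ?thesis by (simp add: cinner_cadjoint[OF T])
qed

section \<open>Powers, and bounded linearity of the left inverse\<close>

lemma bounded_clinear_compose:
  "bounded_clinear S \<Longrightarrow> bounded_clinear T \<Longrightarrow> bounded_clinear (S \<circ> T)"
  using bounded_linear_compose[of S T] by (simp add: bounded_clinear_def o_def)

lemma bounded_clinear_id: "bounded_clinear id"
  by (simp add: bounded_clinear_def id_def bounded_linear_ident)

lemma bounded_clinear_funpow: "bounded_clinear T \<Longrightarrow> bounded_clinear (T ^^ n)"
  by (induction n) (auto intro: bounded_clinear_compose bounded_clinear_id)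

lemma left_inverse_funpow_apply:
  fixes S T :: "'a \<Rightarrow> 'a"
  assumes "\<And>x. S (T x) = x"
  shows "(S ^^ n) ((T ^^ n) x) = x"
  by (induction n arbitrary: x) (simp_all add: assms funpow_swap1[of S])

lemma left_invertible_funpow:
  assumes "left_invertible T"
  shows "left_invertible (T ^^ n)"
proof -
  obtain S where S: "bounded_clinear S" "S \<circ> T = id" using assms by (auto simp: left_invertible_def)
  then have "S ^^ n \<circ> T ^^ n = id"
    using left_inverse_funpow_apply[of S T] by (auto simp: fun_eq_iff)
  with S show ?thesis unfolding left_invertible_def using bounded_clinear_funpow by blast
qed

lemma bounded_clinear_left_inverse:
  fixes T :: "'a::chilbert_space \<Rightarrow> 'a"
  assumes T: "bounded_clinear T" and inv: "left_invertible T"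
  shows "bounded_clinear (left_inverse T)" and "left_inverse T (T x) = x"
proof -
  let ?L = "left_inverse T"
  interpret T: bounded_linear T using T by (simp add: bounded_clinear_def)
  have sc: "\<And>c x. T (c *\<^sub>C x) = c *\<^sub>C T x" using T by (auto simp: bounded_clinear_def)
  obtain c where c: "c > 0" "\<And>x. c * norm x \<le> norm (T x)"
    using left_invertible_bounded_below[OF inv] by blast
  \<comment> \<open>The normal equations have only one solution because \<open>T\<close> is bounded
    below. Each algebraic identity for \<open>?L\<close> then follows by exhibiting a
    solution.\<close>
  have eqI: "?L y = u" if "\<And>x. cinner (T x) (T u) = cinner (T x) y" for u y
  proof -
    have "cinner (T (?L y - u)) (T (?L y - u)) = 0"
      using cinner_left_inverse[OF T inv] that by (simp add: T.diff cinner_diff_left cinner_diff_right)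
    then show ?thesis using c(2)[of "?L y - u"] c(1) by (simp add: cinner_self_eq_0 mult_le_0_iff)
  qed
  show "?L (T x) = x" by (rule eqI) simp
  have add: "?L (x + y) = ?L x + ?L y" for x y
    by (rule eqI) (simp add: T.add cinner_add_right cinner_left_inverse[OF T inv])
  have scC: "?L (a *\<^sub>C x) = a *\<^sub>C ?L x" for a x
    by (rule eqI) (simp add: sc cinner_scaleC_right cinner_left_inverse[OF T inv])
  \<comment> \<open>A projection does not increase norms; the lower bound for \<open>T\<close> turns
    this into a bound for \<open>?L\<close>.\<close>
  have bound: "norm (?L y) \<le> norm y * (1 / c)" for y
  proof -
    have "(norm (T (?L y)))\<^sup>2 = inner (T (?L y)) y"
      by (simp add: power2_norm_eq_inner inner_eq_Re_cinner cinner_left_inverse[OF T inv])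
    also have "\<dots> \<le> norm (T (?L y)) * norm y" by (rule norm_cauchy_schwarz)
    finally have "norm (T (?L y)) \<le> norm y"
      by (cases "norm (T (?L y)) = 0") (simp_all add: power2_eq_square)
    with c(2)[of "?L y"] c(1) show ?thesis by (simp add: field_simps)
  qed
  have "bounded_linear ?L"
  proof (rule bounded_linear_intro)
    show "?L (a *\<^sub>R x) = a *\<^sub>R ?L x" for a x
      using scC[of "of_real a" x] by (simp add: scaleC_of_real)
  qed (fact add bound)+
  with scC show "bounded_clinear ?L" by (simp add: bounded_clinear_def)
qed

section \<open>Orthogonal series\<close>

lemma orthogonal_family_Pythagorean:
  assumes "orthogonal_family M" "\<And>n. f n \<in> M n" "finite I"
  shows "(norm (sum f I))\<^sup>2 = (\<Sum>n\<in>I. (norm (f n))\<^sup>2)"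
  using assms
  by (intro norm_sum_Pythagorean)
    (auto simp: pairwise_def orthogonal_family_def corthogonal_def intro!: orthogonal_if_cinner_eq_0)

text \<open>By Pythagoras, blocks of the series have the same squared norm as blocks of the series
  of squares, so the Cauchy criterion transfers.\<close>

lemma orthogonal_family_summable:
  assumes M: "orthogonal_family M" "\<And>n. f n \<in> M n" and s: "summable (\<lambda>n. (norm (f n))\<^sup>2)"
  shows "summable f"
  unfolding summable_Cauchy
proof (intro allI impI)
  fix e :: real assume e: "e > 0"
  then obtain N where N: "\<And>m n. m \<ge> N \<Longrightarrow> norm (\<Sum>k=m..<n. (norm (f k))\<^sup>2) < e\<^sup>2"
    using s unfolding summable_Cauchy by (metis zero_less_power)
  have "norm (sum f {m..<n}) < e" if "m \<ge> N" for m n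
    using N[OF that, of n] e orthogonal_family_Pythagorean[OF M, of "{m..<n}"]
    by (simp add: power2_less_imp_less)
  then show "\<exists>N. \<forall>m\<ge>N. \<forall>n. norm (sum f {m..<n}) < e" by blast
qed

lemma sums_cinner_eq_0:
  assumes "f sums x" "\<And>n. cinner (f n) y = 0"
  shows "cinner x y = 0"
proof -
  have "(\<lambda>n. cinner (f n) y) sums cinner x y"
    by (rule bounded_linear.sums[OF bounded_linear_cinner_left assms(1)])
  then have "(\<lambda>n. 0) sums cinner x y" by (simp only: assms(2))
  then show ?thesis by (rule sums_unique2) (rule sums_zero)
qed

section \<open>The Wold-type decomposition\<close>

text \<open>Invariance of a set under \<open>T\<close> makes its complement invariant under
  \<open>cadjoint T\<close>. This is applied to \<open>M\<close> and to its complement, where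
  \<open>M_eq\<close> identifies the double complement.\<close>

lemma reducing_subspace_ortho_complement:
  fixes T :: "'a::chilbert_space \<Rightarrow> 'a"
  assumes T: "bounded_clinear T" and M: "T ` M \<subseteq> M"
    and M': "T ` ortho_complement M \<subseteq> ortho_complement M" and closed: "closed_csubspace M"
    and M_eq: "M = ortho_complement (ortho_complement M)"
  shows "reducing_subspace T M" "reducing_subspace T (ortho_complement M)"
proof -
  have adj: "cadjoint T ` ortho_complement N \<subseteq> ortho_complement N" if "T ` N \<subseteq> N" for N
  proof -
    have "cinner (cadjoint T x) y = 0" if "x \<in> ortho_complement N" "y \<in> N" for x y
    proof -
      have "cinner x (T y) = 0" using that \<open>T ` N \<subseteq> N\<close> by (auto simp: ortho_complement_def)
      then show ?thesis
        by (metis cinner_cadjoint[OF T] cinner_eq_0_commute)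
    qed
    then show ?thesis by (auto simp: ortho_complement_def)
  qed
  show "reducing_subspace T M"
    using M closed adj[OF M'] M_eq by (simp add: reducing_subspace_def)
  show "reducing_subspace T (ortho_complement M)"
    using M' adj[OF M] closed_csubspace_ortho_complement by (simp add: reducing_subspace_def)
qed

section \<open>Operators of class D and the projections \<open>T ^^ n \<circ> L ^^ n\<close>\<close>

locale class_D_operator =
  fixes T :: "'a::chilbert_space \<Rightarrow> 'a"
  assumes class_D: "T \<in> class_D"
begin

abbreviation L where "L \<equiv> left_inverse T"
abbreviation W where "W \<equiv> ortho_complement (range T)"
abbreviation H_inf where "H_inf \<equiv> \<Inter>n\<in>{1..}. range (T ^^ n)"
abbreviation H_s where "H_s \<equiv> hilbert_direct_sum (\<lambda>n. (T ^^ n) ` W)"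

lemma bounded_clinear_T: "bounded_clinear T" and left_invertible_T: "left_invertible T"
  using class_D by (auto simp: class_D_def)

lemma L_T [simp]: "L (T x) = x"
  by (rule bounded_clinear_left_inverse[OF bounded_clinear_T left_invertible_T])

lemma Lpow_Tpow [simp]: "(L ^^ n) ((T ^^ n) x) = x"
  by (rule left_inverse_funpow_apply) simp

lemma bounded_clinear_Tpow: "bounded_clinear (T ^^ n)"
  and bounded_clinear_Lpow: "bounded_clinear (L ^^ n)"
  by (simp_all add: bounded_clinear_funpow bounded_clinear_T
      bounded_clinear_left_inverse[OF bounded_clinear_T left_invertible_T])

lemma bounded_linear_Tpow: "bounded_linear (T ^^ n)" and bounded_linear_Lpow: "bounded_linear (L ^^ n)"
  using bounded_clinear_Tpow bounded_clinear_Lpow by (auto simp: bounded_clinear_def)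

lemma bounded_linear_T: "bounded_linear T"
  using bounded_clinear_T by (simp add: bounded_clinear_def)

lemmas Tpow_linear_simps =
  linear_simps(1,2,3)[OF bounded_linear_Tpow]
lemmas Lpow_linear_simps =
  linear_simps(1,2,3)[OF bounded_linear_Lpow]

lemma scaleC_Tpow: "(T ^^ n) (c *\<^sub>C x) = c *\<^sub>C (T ^^ n) x"
  and scaleC_Lpow: "(L ^^ n) (c *\<^sub>C x) = c *\<^sub>C (L ^^ n) x"
  using bounded_clinear_Tpow bounded_clinear_Lpow by (auto simp: bounded_clinear_def)

text \<open>The power condition of \<open>class_D\<close> enters here. It starts at exponent 2;
  exponent 1 is trivial, and for exponent 0 the left inverse of the identity is the
  identity.\<close>

lemma left_inverse_Tpow: "left_inverse (T ^^ n) = L ^^ n"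
proof (cases n)
  case 0
  show ?thesis
  proof
    fix x :: 'a
    have "left_inverse (T ^^ 0) ((T ^^ 0) x) = x"
      by (intro bounded_clinear_left_inverse(2) bounded_clinear_Tpow
          left_invertible_funpow left_invertible_T)
    with 0 show "left_inverse (T ^^ n) x = (L ^^ n) x" by simp
  qed
next
  case (Suc m)
  then have "n = 1 \<or> n \<ge> 2" by auto
  then show ?thesis using class_D by (auto simp: class_D_def)
qed

lemma cinner_Tpow_projection: "cinner ((T ^^ n) x) ((T ^^ n) ((L ^^ n) y)) = cinner ((T ^^ n) x) y"
  using cinner_left_inverse[OF bounded_clinear_Tpow left_invertible_funpow[OF left_invertible_T]]
  by (simp add: left_inverse_Tpow)

text \<open>The projection of \<open>x\<close> onto the range vanishes exactly when \<open>x\<close>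
  is orthogonal to the range; cancelling \<open>T ^^ n\<close> leaves
  \<open>(L ^^ n) x = 0\<close>.\<close>

lemma Lpow_eq_0_iff: "(L ^^ n) x = 0 \<longleftrightarrow> x \<in> ortho_complement (range (T ^^ n))"
proof
  assume "(L ^^ n) x = 0"
  then show "x \<in> ortho_complement (range (T ^^ n))"
    using cinner_Tpow_projection[of n _ x]
    by (auto simp: ortho_complement_def Tpow_linear_simps cinner_eq_0_commute[of x])
next
  assume "x \<in> ortho_complement (range (T ^^ n))"
  then have "cinner ((T ^^ n) ((L ^^ n) x)) ((T ^^ n) ((L ^^ n) x)) = 0"
    unfolding cinner_Tpow_projection by (auto simp: ortho_complement_def cinner_eq_0_commute[of x])
  then have "(L ^^ n) ((T ^^ n) ((L ^^ n) x)) = (L ^^ n) 0" by (simp add: cinner_self_eq_0)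
  then show "(L ^^ n) x = 0" by (simp add: Lpow_linear_simps)
qed

section \<open>Ranges of the powers and images of \<open>W\<close>\<close>

lemma W_iff: "x \<in> W \<longleftrightarrow> L x = 0"
  using Lpow_eq_0_iff[of 1 x] by simp

text \<open>The range becomes the fixed-point set of a bounded operator, so closedness and linear
  closure properties become equational.\<close>

lemma range_Tpow_iff: "x \<in> range (T ^^ n) \<longleftrightarrow> (T ^^ n) ((L ^^ n) x) = x"
proof
  show "(T ^^ n) ((L ^^ n) x) = x" if "x \<in> range (T ^^ n)"
    using that by (auto simp del: funpow.simps)
qed (metis rangeI)

lemma range_Tpow_antimono: "m \<le> n \<Longrightarrow> range (T ^^ n) \<subseteq> range (T ^^ m)"
  by (auto simp: funpow_add dest!: le_Suc_ex)

lemma TpowW_iff: "x \<in> (T ^^ n) ` W \<longleftrightarrow> (T ^^ n) ((L ^^ n) x) = x \<and> (L ^^ n) x \<in> W"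
  by (metis (no_types, lifting) Lpow_Tpow image_iff)

text \<open>If \<open>x = (T ^^ m) w\<close> with \<open>w \<in> W\<close>, then
  \<open>(L ^^ Suc m) x = L w = 0\<close>, so \<open>x\<close> is orthogonal to the range of
  \<open>T ^^ Suc m\<close>, which contains that of \<open>T ^^ n\<close>.\<close>

lemma cinner_TpowW:
  assumes "x \<in> (T ^^ m) ` W" "y \<in> range (T ^^ n)" "m < n"
  shows "cinner x y = 0"
proof -
  have "(L ^^ Suc m) x = 0" using assms(1) by (auto simp: TpowW_iff W_iff)
  moreover have "y \<in> range (T ^^ Suc m)" using range_Tpow_antimono[of "Suc m" n] assms by auto
  ultimately show ?thesis unfolding Lpow_eq_0_iff ortho_complement_def by blast
qed

lemma corthogonal_TpowW:
  assumes "m \<noteq> n"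
  shows "corthogonal ((T ^^ m) ` W) ((T ^^ n) ` W)"
  unfolding corthogonal_def
proof (intro ballI)
  fix x y assume xy: "x \<in> (T ^^ m) ` W" "y \<in> (T ^^ n) ` W"
  show "cinner x y = 0"
  proof (cases "m < n")
    case True
    with xy show ?thesis by (intro cinner_TpowW[OF xy(1)]) auto
  next
    case False
    with xy assms show ?thesis
      by (subst cinner_eq_0_commute) (intro cinner_TpowW[OF xy(2)], auto)
  qed
qed

lemma wandering_subspace_W: "wandering_subspace T W"
  by (simp add: wandering_subspace_def closed_csubspace_ortho_complement corthogonal_TpowW)

lemma closed_range_Tpow: "closed (range (T ^^ n))"
proof -
  have "range (T ^^ n) = {x. (T ^^ n) ((L ^^ n) x) = x}" using range_Tpow_iff by blast
  then show ?thesis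
    by (simp only:) (intro closed_Collect_eq continuous_on_id
        bounded_linear.continuous_on[OF bounded_linear_Tpow]
        bounded_linear.continuous_on[OF bounded_linear_Lpow])
qed

lemma closed_csubspace_TpowW: "closed_csubspace ((T ^^ n) ` W)"
proof (rule closed_csubspaceI)
  have W: "closed_csubspace W" by (rule closed_csubspace_ortho_complement)
  then show "0 \<in> (T ^^ n) ` W"
    by (simp add: TpowW_iff closed_csubspace_def subspace_0 Tpow_linear_simps Lpow_linear_simps)
  show "x + y \<in> (T ^^ n) ` W" if "x \<in> (T ^^ n) ` W" "y \<in> (T ^^ n) ` W" for x y
    using that W
    by (simp add: TpowW_iff closed_csubspace_def subspace_add Tpow_linear_simps Lpow_linear_simps)
  show "c *\<^sub>C x \<in> (T ^^ n) ` W" if "x \<in> (T ^^ n) ` W" for c x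
    using that W by (simp add: TpowW_iff closed_csubspace_def scaleC_Tpow scaleC_Lpow)
  have "(T ^^ n) ` W = range (T ^^ n) \<inter> (L ^^ n) -` W"
    unfolding set_eq_iff by (simp only: Int_iff TpowW_iff range_Tpow_iff vimage_eq simp_thms)
  moreover have "closed ((L ^^ n) -` W)"
    using W bounded_linear.continuous_on[OF bounded_linear_Lpow continuous_on_id]
    by (intro continuous_closed_vimage) (auto simp: closed_csubspace_def linear_continuous_at bounded_linear_Lpow)
  ultimately show "closed ((T ^^ n) ` W)" by (simp add: closed_Int closed_range_Tpow)
qed

lemma orthogonal_family_TpowW: "orthogonal_family (\<lambda>n. (T ^^ n) ` W)"
  by (simp add: orthogonal_family_def closed_csubspace_TpowW corthogonal_TpowW)

section \<open>The subspace \<open>H_inf\<close>\<close>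

lemma H_inf_iff: "x \<in> H_inf \<longleftrightarrow> (\<forall>n. x \<in> range (T ^^ n))"
proof -
  have "x \<in> range (T ^^ n)" if "\<forall>n\<in>{1..}. x \<in> range (T ^^ n)" for n
  proof (cases "n = 0")
    case False
    then have "n \<in> {1..}" by simp
    with that show ?thesis by blast
  qed simp
  then show ?thesis by auto
qed

lemma closed_csubspace_H_inf: "closed_csubspace H_inf"
proof (rule closed_csubspaceI)
  show "closed H_inf" by (intro closed_INT ballI closed_range_Tpow)
qed (simp_all only: H_inf_iff range_Tpow_iff Tpow_linear_simps Lpow_linear_simps
    scaleC_Tpow scaleC_Lpow simp_thms)

lemma T_H_inf: "T ` H_inf = H_inf"
proof (intro equalityI subsetI)
  fix y assume "y \<in> T ` H_inf"
  then obtain x where x: "x \<in> H_inf" "y = T x" by blast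
  have "y \<in> range (T ^^ n)" for n
  proof -
    obtain z where "x = (T ^^ n) z" using x(1) unfolding H_inf_iff by blast
    then have "y = (T ^^ n) (T z)" using x(2) by (simp add: funpow_swap1)
    then show ?thesis by blast
  qed
  then show "y \<in> H_inf" unfolding H_inf_iff by blast
next
  fix y assume y: "y \<in> H_inf"
  \<comment> \<open>\<open>L\<close> strips one factor \<open>T\<close>, hence the exponent
    \<open>Suc n\<close> below. This makes \<open>L y\<close> the preimage of \<open>y\<close>
    inside \<open>H_inf\<close>.\<close>
  have "L y \<in> range (T ^^ n)" for n
  proof -
    obtain z where "y = (T ^^ Suc n) z" using y unfolding H_inf_iff by blast
    then show ?thesis by simp
  qed
  moreover have "y = T (L y)"
    using y range_Tpow_iff[of y 1] unfolding H_inf_iff by (auto dest: spec[of _ 1])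
  ultimately show "y \<in> T ` H_inf" unfolding H_inf_iff[symmetric] by blast
qed

lemma bij_betw_H_inf: "bij_betw T H_inf H_inf"
  using T_H_inf by (simp only: bij_betw_def) (metis L_T inj_on_inverseI)

section \<open>Existence of the decomposition and reduction of \<open>T\<close>\<close>

lemma corthogonal_H_inf_H_s: "corthogonal H_inf H_s"
  unfolding corthogonal_def
proof (intro ballI)
  fix x y assume x: "x \<in> H_inf" and "y \<in> H_s"
  then obtain f where f: "\<And>n. f n \<in> (T ^^ n) ` W" "f sums y"
    by (auto simp: hilbert_direct_sum_def)
  have "cinner (f n) x = 0" for n
    using x unfolding H_inf_iff by (intro cinner_TpowW[OF f(1), of _ "Suc n"]) (blast, simp)
  then have "cinner y x = 0" using f(2) by (rule sums_cinner_eq_0[rotated])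
  then show "cinner x y = 0" by (subst cinner_eq_0_commute)
qed

lemma H_inf_H_s_decompose: "\<exists>a\<in>H_inf. \<exists>b\<in>H_s. x = a + b"
proof -
  \<comment> \<open>Difference of the projections of \<open>x\<close> onto two consecutive
    ranges.\<close>
  define f where "f n = (T ^^ n) ((L ^^ n) x) - (T ^^ Suc n) ((L ^^ Suc n) x)" for n
  have f_in: "f n \<in> (T ^^ n) ` W" for n
  proof -
    have "f n = (T ^^ n) ((L ^^ n) x - T (L ((L ^^ n) x)))"
      by (simp add: f_def Tpow_linear_simps funpow_swap1)
    moreover have "(L ^^ n) x - T (L ((L ^^ n) x)) \<in> W"
      using Lpow_linear_simps(2)[of 1] by (simp add: W_iff)
    ultimately show ?thesis by blast
  qed
  have partial: "(\<Sum>k<n. f k) = x - (T ^^ n) ((L ^^ n) x)" for n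
    by (induction n) (simp_all add: f_def)
  \<comment> \<open>Bessel's inequality: a partial sum is \<open>x\<close> minus its projection, so
    it is orthogonal to that projection.\<close>
  have "(\<Sum>k<n. (norm (f k))\<^sup>2) \<le> (norm x)\<^sup>2" for n
  proof -
    have "orthogonal ((T ^^ n) ((L ^^ n) x)) (x - (T ^^ n) ((L ^^ n) x))"
      by (intro orthogonal_if_cinner_eq_0) (simp add: cinner_diff_right cinner_Tpow_projection)
    from norm_add_Pythagorean[OF this]
    have "(norm x)\<^sup>2 = (norm ((T ^^ n) ((L ^^ n) x)))\<^sup>2 + (norm (\<Sum>k<n. f k))\<^sup>2"
      by (simp add: partial)
    then show ?thesis by (simp add: orthogonal_family_Pythagorean[OF orthogonal_family_TpowW f_in])
  qed
  then have sq: "summable (\<lambda>n. (norm (f n))\<^sup>2)"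
    by (intro summableI_nonneg_bounded) auto
  define b where "b = suminf f"
  have b: "f sums b"
    unfolding b_def
    using orthogonal_family_summable[OF orthogonal_family_TpowW f_in sq] by (rule summable_sums)
  have "(\<lambda>n. x - (\<Sum>k<n. f k)) \<longlonglongrightarrow> x - b"
    using b unfolding sums_def by (intro tendsto_intros)
  then have lim: "(\<lambda>n. (T ^^ n) ((L ^^ n) x)) \<longlonglongrightarrow> x - b" by (simp add: partial)
  \<comment> \<open>The ranges decrease, so the projections of \<open>x\<close> eventually stay in
    any fixed one, which is closed.\<close>
  have "x - b \<in> range (T ^^ m)" for m
  proof (rule Lim_in_closed_set[OF closed_range_Tpow _ _ lim])
    show "\<forall>\<^sub>F n in sequentially. (T ^^ n) ((L ^^ n) x) \<in> range (T ^^ m)"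
      using eventually_ge_at_top[of m]
      by eventually_elim (use range_Tpow_antimono in blast)
  qed simp
  then have "x - b \<in> H_inf" unfolding H_inf_iff by blast
  moreover have "b \<in> H_s" using b sq f_in by (auto simp: hilbert_direct_sum_def)
  ultimately show ?thesis by (metis diff_add_cancel)
qed

text \<open>Also the source of closedness of \<open>H_s\<close>, which its description by series
  does not show directly.\<close>

lemma H_inf_H_s_complements: "H_inf = ortho_complement H_s" "H_s = ortho_complement H_inf"
proof -
  have "0 \<in> (T ^^ n) ` W" for n
    using closed_csubspace_TpowW by (simp add: closed_csubspace_def subspace_0)
  then have "0 \<in> H_s" by (auto simp: hilbert_direct_sum_def intro!: exI[of _ "\<lambda>_. 0"])
  moreover have "0 \<in> H_inf"
    using closed_csubspace_H_inf by (simp only: closed_csubspace_def subspace_0)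
  ultimately show "H_inf = ortho_complement H_s" "H_s = ortho_complement H_inf"
    using orthogonal_decomposition_complements[OF _ _ corthogonal_H_inf_H_s H_inf_H_s_decompose]
    by blast+
qed

lemma orthogonal_decomposition_H: "orthogonal_decomposition H_inf H_s"
  unfolding orthogonal_decomposition_def
  using closed_csubspace_H_inf closed_csubspace_ortho_complement[of H_inf]
    corthogonal_H_inf_H_s H_inf_H_s_decompose H_inf_H_s_complements(2) by metis

text \<open>Membership in \<open>H_s\<close> is tested as orthogonality to \<open>H_inf\<close>:
  \<open>T (f n)\<close> lies in the image of \<open>W\<close> under \<open>T ^^ Suc n\<close> and
  so is orthogonal to the range of \<open>T ^^ Suc (Suc n)\<close>.\<close>

lemma T_H_s: "T ` H_s \<subseteq> H_s"
proof
  fix y assume "y \<in> T ` H_s"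
  then obtain x f where f: "\<And>n. f n \<in> (T ^^ n) ` W" "f sums x" and y: "y = T x"
    by (auto simp: hilbert_direct_sum_def)
  have Tf: "(\<lambda>n. T (f n)) sums y"
    unfolding y by (rule bounded_linear.sums[OF bounded_linear_T f(2)])
  have "cinner (T (f n)) z = 0" if z: "z \<in> H_inf" for n z
  proof (rule cinner_TpowW)
    show "T (f n) \<in> (T ^^ Suc n) ` W" using f(1)[of n] by auto
    show "z \<in> range (T ^^ Suc (Suc n))" using z unfolding H_inf_iff by blast
  qed simp
  then have "cinner y z = 0" if "z \<in> H_inf" for z
    using that sums_cinner_eq_0[OF Tf] by blast
  then have "y \<in> ortho_complement H_inf" by (simp only: ortho_complement_def mem_Collect_eq) blast
  then show "y \<in> H_s" unfolding H_inf_H_s_complements(2)[symmetric] .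
qed

lemma reducing_subspaces_H: "reducing_subspace T H_inf" "reducing_subspace T H_s"
proof -
  note c = H_inf_H_s_complements
  have "T ` ortho_complement H_inf \<subseteq> ortho_complement H_inf"
    using T_H_s unfolding c(2)[symmetric] .
  moreover have "H_inf = ortho_complement (ortho_complement H_inf)"
    unfolding c(2)[symmetric] by (rule c(1))
  ultimately show "reducing_subspace T H_inf" "reducing_subspace T H_s"
    using reducing_subspace_ortho_complement[OF bounded_clinear_T _ _ closed_csubspace_H_inf]
      T_H_inf c(2) by (metis equalityD1)+
qed

section \<open>Uniqueness\<close>

text \<open>Bijectivity on \<open>A\<close> gives \<open>A \<subseteq> H_inf\<close>. Equality
  follows once \<open>B\<close> meets \<open>H_inf\<close> only in 0, and then \<open>B\<close> is
  determined as the complement of \<open>A\<close>.\<close>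

lemma H_inf_H_s_unique:
  assumes dec: "orthogonal_decomposition A B"
    and redB: "reducing_subspace T B"
    and bij: "bij_betw T A A" and W': "wandering_subspace T W'"
    and B: "B = hilbert_direct_sum (\<lambda>n. (T ^^ n) ` W')"
  shows "A = H_inf \<and> B = H_s"
proof -
  have AB: "\<And>a b. a \<in> A \<Longrightarrow> b \<in> B \<Longrightarrow> cinner a b = 0"
    and closed: "closed_csubspace A" "closed_csubspace B"
    and split: "\<And>x. \<exists>a\<in>A. \<exists>b\<in>B. x = a + b"
    using dec by (auto simp: orthogonal_decomposition_def corthogonal_def)
  have Apow: "(T ^^ n) ` A = A" for n
    using bij_betw_funpow[OF bij] by (simp add: bij_betw_def)
  have Bpow: "(T ^^ n) b \<in> B" if "b \<in> B" for n b
    using redB that by (induction n) (auto simp: reducing_subspace_def)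
  have sub: "A \<subseteq> H_inf"
    using Apow by (metis (no_types, lifting) INT_greatest image_mono subset_UNIV)
  have trivial: "b = 0" if b: "b \<in> B" "b \<in> H_inf" for b
  proof -
    obtain f where f: "\<And>n. f n \<in> (T ^^ n) ` W'" "f sums b"
      using b(1) B by (auto simp: hilbert_direct_sum_def)
    \<comment> \<open>Each component of \<open>b\<close> is shown to be orthogonal to
      \<open>b\<close> itself, which forces \<open>b = 0\<close>.\<close>
    have "cinner (f m) b = 0" for m
    proof -
      obtain y where y: "b = (T ^^ Suc m) y" using b(2) unfolding H_inf_iff by blast
      obtain a d where ad: "a \<in> A" "d \<in> B" "y = a + d" using split by blast
      \<comment> \<open>This vector lies in both \<open>A\<close> and \<open>B\<close>, hence is
        zero, so the preimage of \<open>b\<close> can be taken to be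
        \<open>d \<in> B\<close>.\<close>
      have eq: "(T ^^ Suc m) a = b - (T ^^ Suc m) d"
        using y ad(3) Tpow_linear_simps(1)[of "Suc m" a d] by simp
      then have "(T ^^ Suc m) a \<in> B"
        using closed_csubspace_diff[OF closed(2) b(1) Bpow[OF ad(2)]] by (simp only:)
      moreover have "(T ^^ Suc m) a \<in> A" using Apow[of "Suc m"] ad(1) by blast
      ultimately have "(T ^^ Suc m) a = 0" using AB cinner_self_eq_0 by blast
      with eq have bd: "b = (T ^^ Suc m) d" by simp
      obtain g where g: "\<And>n. g n \<in> (T ^^ n) ` W'" "g sums d"
        using ad(2) B by (auto simp: hilbert_direct_sum_def)
      \<comment> \<open>Applying \<open>T ^^ Suc m\<close> shifts the expansion of \<open>d\<close>
        to indices above \<open>m\<close>, which misses the summand containing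
        \<open>f m\<close>.\<close>
      have "cinner ((T ^^ Suc m) (g k)) (f m) = 0" for k
      proof -
        obtain w where w: "w \<in> W'" "g k = (T ^^ k) w" using g(1) by blast
        then have "(T ^^ Suc m) (g k) = (T ^^ (Suc m + k)) w"
          by (simp only: funpow_add comp_apply)
        then have "(T ^^ Suc m) (g k) \<in> (T ^^ (Suc m + k)) ` W'" using w(1) by blast
        moreover have "corthogonal ((T ^^ (Suc m + k)) ` W') ((T ^^ m) ` W')"
          using W' by (simp add: wandering_subspace_def del: funpow.simps)
        ultimately show ?thesis using f(1)[of m] by (simp only: corthogonal_def)
      qed
      then have "cinner b (f m) = 0"
        unfolding bd
        by (rule sums_cinner_eq_0[OF bounded_linear.sums[OF bounded_linear_Tpow g(2)]])
      then show ?thesis by (subst cinner_eq_0_commute)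
    qed
    then have "cinner b b = 0" using f(2) by (rule sums_cinner_eq_0[rotated])
    then show "b = 0" by (simp add: cinner_self_eq_0)
  qed
  have "H_inf \<subseteq> A"
  proof
    fix x assume x: "x \<in> H_inf"
    obtain a b where ab: "a \<in> A" "b \<in> B" "x = a + b" using split by blast
    have "x - a \<in> H_inf" using closed_csubspace_diff[OF closed_csubspace_H_inf x] sub ab(1) by blast
    then have "b = 0" using trivial[OF ab(2)] ab(3) by simp
    with ab show "x \<in> A" by simp
  qed
  with sub have A: "A = H_inf" by blast
  have "B = ortho_complement A"
    using closed AB split
    by (intro orthogonal_decomposition_complements)
      (auto simp: closed_csubspace_def subspace_0 corthogonal_def)
  then have "B = H_s" unfolding A H_inf_H_s_complements(2)[symmetric] .
  with A show ?thesis by blast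
qed

end

text \<open>The conjunct on \<open>orthogonal_family\<close> ensures that
  \<open>hilbert_direct_sum\<close> in \<open>H_s\<close> is a genuine orthogonal Hilbert sum of
  closed subspaces.\<close>

theorem theorem2:
  fixes T :: "'a::chilbert_space \<Rightarrow> 'a" and W H_inf H_s :: "'a set"
  assumes "T \<in> class_D"
    and "W = ortho_complement (range T)"
    and "H_inf = (\<Inter>n\<in>{1..}. range (T ^^ n))"
    and "H_s = hilbert_direct_sum (\<lambda>n. (T ^^ n) ` W)"
  shows "wandering_subspace T W
    \<and> orthogonal_family (\<lambda>n. (T ^^ n) ` W)
    \<and> orthogonal_decomposition H_inf H_s
    \<and> reducing_subspace T H_inf
    \<and> reducing_subspace T H_s
    \<and> bij_betw T H_inf H_inf
    \<and> (\<forall>H_inf' H_s' W'.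
         orthogonal_decomposition H_inf' H_s'
         \<and> reducing_subspace T H_inf'
         \<and> reducing_subspace T H_s'
         \<and> bij_betw T H_inf' H_inf'
         \<and> wandering_subspace T W'
         \<and> H_s' = hilbert_direct_sum (\<lambda>n. (T ^^ n) ` W')
         \<longrightarrow> H_inf' = H_inf \<and> H_s' = H_s)"
proof -
  interpret class_D_operator T by unfold_locales fact
  show ?thesis
    unfolding assms(2-4)
    using wandering_subspace_W orthogonal_family_TpowW orthogonal_decomposition_H
      reducing_subspaces_H bij_betw_H_inf H_inf_H_s_unique
    by blast
qed

end
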